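(* Let $[a,b]$ be a closed real number interval, let $c\in[a,b]$, and let $\beta_1,\dots,\beta_5$ be real constants with $\beta_1\neq 0$. Let $\mathcal{R}^{(6)}$ be the $6$-dimensional truncated polynomial real algebra with basis $1,\varepsilon,\dots,\varepsilon^5$ and $\varepsilon^6=0$. For $x\in\mathcal{R}$ let $\mathcal{R}^{(6)}_x:=\{x+\sum_{i=1}^5 a_i\varepsilon^i \mid a_1,\dots,a_5\in\mathcal{R}\}$. For each $x\in\mathcal{R}$ and each $f\in\mathbf{D}^5(x)$ define $\Lambda(f):\mathcal{R}^{(6)}_x\to\mathcal{R}^{(6)}$ by $$ \begin{aligned} \Lambda(f)\Big(x+\sum_{i=1}^5 a_i\varepsilon^i\Big):={}& f(x)+a_1f'(x)\,\varepsilon+\Big(a_2f'(x)+\tfrac{1}{2!}a_1^2f^{(2)}(x)\Big)\varepsilon^2\\ &+\Big(a_3f'(x)+a_1a_2f^{(2)}(x)+\tfrac{1}{3!}a_1^3f^{(3)}(x)\Big)\varepsilon^3\\ &+\Big[a_4f'(x)+\big(a_1a_3+\tfrac12a_2^2\big)f^{(2)}(x)+\tfrac12a_1^2a_2f^{(3)}(x)+\tfrac{1}{4!}a_1^4f^{(4)}(x)\Big]\varepsilon^4\\ &+\Big[a_5f'(x)+(a_1a_4+a_2a_3)f^{(2)}(x)+\tfrac12(a_1^2a_3+a_1a_2^2)f^{(3)}(x)\\ &\qquad+\tfrac16a_1^3a_2f^{(4)}(x)+\tfrac{1}{5!}a_1^5f^{(5)}(x)\Big]\varepsilon^5 . \end{aligned}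 $$ Define real numbers $A_5,A_4,A_3,A_2,A_1$ by $$ \begin{aligned} A_5&:=\frac{(b-c)^6-(a-c)^6}{6\beta_1^5},\\ A_4&:=\frac{(b-c)^5-(a-c)^5}{5\beta_1^4}-\frac{4\beta_2A_5}{\beta_1},\\ A_3&:=\frac{(b-c)^4-(a-c)^4}{4\beta_1^3}-\frac{3\beta_2A_4}{\beta_1}-3\Big(\frac{\beta_3}{\beta_1}+\frac{\beta_2^2}{\beta_1^2}\Big)A_5,\\ A_2&:=\frac{(b-c)^3-(a-c)^3}{3\beta_1^2}-\frac{2\beta_2A_3}{\beta_1}-\Big(\frac{2\beta_3}{\beta_1}+\frac{\beta_2^2}{\beta_1^2}\Big)A_4-2\Big(\frac{\beta_4}{\beta_1}+\frac{\beta_2\beta_3}{\beta_1^2}\Big)A_5,\\ A_1&:=\frac{(b-c)^2-(a-c)^2}{2\beta_1}-\frac{\beta_2A_2}{\beta_1}-\frac{\beta_3A_3}{\beta_1}-\frac{\beta_4A_4}{\beta_1}-\frac{\beta_5A_5}{\beta_1}. \end{aligned} $$ Define $\Omega_{\beta_1,\dots,\beta_5}:\mathcal{R}\to\mathcal{R}^{(6)}$ and $\Gamma_{\beta_1,\dots,\beta_5}:\mathcal{R}^{(6)}\to\mathcal{R}$ by $$ \Omega_{\beta_1,\dots,\beta_5}(x):=x+\sum_{i=1}^5\beta_i\varepsilon^i,\qquad \Gamma_{\beta_1,\dots,\beta_5}\Big(\sum_{i=0}^5y_i\varepsilon^i\Big):=(b-a)y_0+\sum_{i=1}^5A_iy_i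 . $$ Then the $3$-tuple $(\Lambda,\Omega_{\beta_1,\dots,\beta_5},\Gamma_{\beta_1,\dots,\beta_5})$ is a $5$th-order automatic integration induced by $\mathcal{R}^{(6)}$ (for the interval $[a,b]$ and the center $c$), with $A_x=\mathcal{R}^{(6)}_x$ for each $x\in\mathcal{R}$.
   Context: $\mathcal{R}$ denotes the field of real numbers. "Unital associative algebra" means an associative algebra with identity. For a positive integer $n$, the truncated polynomial real algebra is $\mathcal{R}^{(n+1)}=\bigoplus_{i=0}^n\mathcal{R}\varepsilon^i$ with $\mathcal{R}\varepsilon^0=\mathcal{R}$, and $\varepsilon^i\cdot\varepsilon^j=\varepsilon^{i+j}$ if $i+j<n+1$ and $0$ if $i+j\ge n+1$. For a non-empty set $S$ and a unital associative real algebra $A$, $\mathbf{F}(S,A)$ is the unital associative real algebra of all functions $S\to A$ with pointwise operations. For $x\in\mathcal{R}$, $\mathbf{D}^n(x)$ is the set of real-valued functions $f$ defined on an open interval of real numbers (containing $x$) such that $f$ has an $n$-th derivative at $x$. Sums, scalar multiples and products are taken pointwise (on the intersection of the domains), and compositions are taken on an open interval around $x$ on which they are defined. $\mathbf{D}^\infty[a,b]$ is the set of all real functions that are analytic on some open interval $I\supseteq[a,b]$. For $f\in\mathbf{D}^\infty[a,b]$ and $c\in[a,b]$, the $n$th-order Taylor polynomial of $f$ with center $c$ is $T_{n;c}(x)=\sum_{i=0}^n\frac{f^{(i)}(c)}{i!}(x-c)^i$. Definition. Let $A$ be a unital associative real algebra, $[a,b]$ a closed real interval, $c\in[a,b]$,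 and $n$ a positive integer. A $3$-tuple $(\Lambda,\Omega,\Gamma)$ consists of maps $\Omega:\mathcal{R}\to A$ and $\Gamma:A\to\mathcal{R}$, and an assignment $\Lambda$ that, for each $x\in\mathcal{R}$, sends each $f\in\mathbf{D}^n(x)$ to an $A$-valued function $\Lambda(f)$ on a subset of $A$. The function $\Lambda(f)$ is understood relative to the point $x$; write $\Lambda|\mathbf{D}^n(x)$ for the resulting map on $\mathbf{D}^n(x)$. The $3$-tuple is called an $n$th-order automatic integration induced by $A$ (for $[a,b]$ and center $c$) if: (i) for each $x\in\mathcal{R}$ there is a subset $A_x\subseteq A$ such that $\Omega(x)\in A_x$, the image of $\Lambda|\mathbf{D}^n(x)$ is contained in $\mathbf{F}(A_x,A)$, and $\Lambda|\mathbf{D}^n(x):\mathbf{D}^n(x)\to\mathbf{F}(A_x,A)$ is real linear; (ii) for all $x\in\mathcal{R}$ and $f,g\in\mathbf{D}^n(x)$, $\Lambda(f\cdot g)(\Omega(x))=\Lambda(f)(\Omega(x))\cdot\Lambda(g)(\Omega(x))$, with all $\Lambda$'s taken relative to $x$; (iii) for all $x\in\mathcal{R}$, $g\in\mathbf{D}^n(x)$ and $f\in\mathbf{D}^n(g(x))$, the image of $\Lambda(g)$ (taken relative to $x$) is contained in $A_{g(x)}$, and $\Lambda(f\circ g)(\Omega(x))=\Lambda(f)\big(\Lambda(g)(\Omega(x))\big)$, where $\Lambda(f\circ g)$ and $\Lambda(g)$ are taken relative to $x$ and $\Lambda(f)$ relative to $g(x)$; (iv) for every $f\in\mathbf{D}^\infty[a,b]$,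 $\big(\Gamma\circ\Lambda(f)\circ\Omega\big)(c)=\int_a^bT_{n;c}(x)\,dx$, where $\Lambda(f)$ is taken relative to $c$. *)

theory Defs
  imports "HOL-Analysis.Analysis" "HOL-Computational_Algebra.Formal_Power_Series"
begin

section \<open>Truncated polynomial real algebras\<close>

text \<open>
  An element of the \<open>(n+1)\<close>-dimensional truncated polynomial algebra is the sequence of its
  coefficients with respect to \<open>\<epsilon>\<^sup>0, \<dots>, \<epsilon>\<^sup>n\<close>, continued by zero.  The dimension
  \<open>n+1\<close> is \<open>CARD('n)\<close>, so that the algebra of dimension 6 is the type \<open>6 trunc_poly\<close>.
\<close>

typedef 'n trunc_poly = "{p :: nat \<Rightarrow> real. \<forall>i \<ge> CARD('n). p i = 0}"
  morphisms tcoeff Abs_trunc_poly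
  by (rule exI[of _ "\<lambda>_. 0"]) simp

setup_lifting type_definition_trunc_poly

lemma trunc_poly_eqI:
  fixes p q :: "'n trunc_poly"
  assumes "\<And>i. i < CARD('n) \<Longrightarrow> tcoeff p i = tcoeff q i"
  shows "p = q"
proof -
  have "tcoeff p i = tcoeff q i" for i
    using assms tcoeff[of p] tcoeff[of q] by (cases "i < CARD('n)") auto
  then show ?thesis
    by (simp add: tcoeff_inject[symmetric] fun_eq_iff)
qed

instantiation trunc_poly :: (finite) "{real_algebra_1, comm_ring_1}"
begin

lift_definition zero_trunc_poly :: "'a trunc_poly" is "\<lambda>_. 0" by simp

lift_definition one_trunc_poly :: "'a trunc_poly" is "\<lambda>i. if i = 0 then 1 else 0"
proof -
  fix i :: nat assume "CARD('a) \<le> i"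
  with zero_less_card_finite[where 'a = 'a] have "0 < i" by (rule less_le_trans)
  then show "(if i = 0 then 1 else 0) = (0 :: real)" by simp
qed

lift_definition plus_trunc_poly :: "'a trunc_poly \<Rightarrow> 'a trunc_poly \<Rightarrow> 'a trunc_poly"
  is "\<lambda>p q i. p i + q i" by simp

lift_definition minus_trunc_poly :: "'a trunc_poly \<Rightarrow> 'a trunc_poly \<Rightarrow> 'a trunc_poly"
  is "\<lambda>p q i. p i - q i" by simp

lift_definition uminus_trunc_poly :: "'a trunc_poly \<Rightarrow> 'a trunc_poly"
  is "\<lambda>p i. - p i" by simp

lift_definition scaleR_trunc_poly :: "real \<Rightarrow> 'a trunc_poly \<Rightarrow> 'a trunc_poly"
  is "\<lambda>r p i. r * p i" by simp

lift_definition times_trunc_poly :: "'a trunc_poly \<Rightarrow> 'a trunc_poly \<Rightarrow> 'a trunc_poly"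
  is "\<lambda>p q i. if i < CARD('a) then (\<Sum>j=0..i. p j * q (i - j)) else 0" by simp

lemma tcoeff_times_fps:
  fixes p q :: "'a trunc_poly"
  shows "i < CARD('a) \<Longrightarrow> tcoeff (p * q) i = fps_nth (Abs_fps (tcoeff p) * Abs_fps (tcoeff q)) i"
  by transfer (simp add: fps_mult_nth)

instance
proof
  fix a b c :: "'a trunc_poly" and r s :: real
  show "a * b * c = a * (b * c)"
  proof (rule trunc_poly_eqI)
    fix i assume i: "i < CARD('a)"
    let ?F = "\<lambda>p :: 'a trunc_poly. Abs_fps (tcoeff p)"
    have "tcoeff (a * b * c) i = fps_nth (?F a * ?F b * ?F c) i"
    proof -
      have "tcoeff (a * b * c) i = (\<Sum>j=0..i. tcoeff (a * b) j * tcoeff c (i - j))"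
        using i by (simp add: times_trunc_poly.rep_eq)
      also have "\<dots> = (\<Sum>j=0..i. fps_nth (?F a * ?F b) j * fps_nth (?F c) (i - j))"
        by (rule sum.cong) (use i in \<open>simp_all add: tcoeff_times_fps\<close>)
      finally show ?thesis by (subst fps_mult_nth)
    qed
    moreover have "tcoeff (a * (b * c)) i = fps_nth (?F a * (?F b * ?F c)) i"
    proof -
      have "tcoeff (a * (b * c)) i = (\<Sum>j=0..i. tcoeff a j * tcoeff (b * c) (i - j))"
        using i by (simp add: times_trunc_poly.rep_eq)
      also have "\<dots> = (\<Sum>j=0..i. fps_nth (?F a) j * fps_nth (?F b * ?F c) (i - j))"
        by (rule sum.cong) (use i in \<open>simp_all add: tcoeff_times_fps\<close>)
      finally show ?thesis by (subst fps_mult_nth)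
    qed
    ultimately show "tcoeff (a * b * c) i = tcoeff (a * (b * c)) i"
      by (simp add: mult.assoc)
  qed
  show comm: "a * b = b * a" for a b :: "'a trunc_poly"
    by (rule trunc_poly_eqI) (simp add: tcoeff_times_fps mult.commute)
  show one_left: "1 * a = a" for a :: "'a trunc_poly"
  proof (rule trunc_poly_eqI)
    fix i assume i: "i < CARD('a)"
    have "Abs_fps (tcoeff (1 :: 'a trunc_poly)) = 1"
      by (rule fps_ext) (simp add: one_trunc_poly.rep_eq)
    then show "tcoeff (1 * a) i = tcoeff a i"
      using i by (simp add: tcoeff_times_fps)
  qed
  show distrib: "(a + b) * c = a * c + b * c" for a b c :: "'a trunc_poly"
    by transfer (auto simp: fun_eq_iff sum.distrib algebra_simps)
  show "a * (b + c) = a * b + a * c"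
    by (simp only: comm[of a] distrib)
  show "a * 1 = a"
    by (simp only: comm[of a] one_left)
  show "(0 :: 'a trunc_poly) \<noteq> 1"
    by transfer (auto dest!: fun_cong[where x = 0])
  show "r *\<^sub>R a * b = r *\<^sub>R (a * b)" "a * r *\<^sub>R b = r *\<^sub>R (a * b)"
    by (transfer; auto simp: fun_eq_iff sum_distrib_left algebra_simps)+
qed (simp_all add: tcoeff_inject[symmetric] fun_eq_iff plus_trunc_poly.rep_eq
    minus_trunc_poly.rep_eq uminus_trunc_poly.rep_eq zero_trunc_poly.rep_eq
    scaleR_trunc_poly.rep_eq algebra_simps)

end

lift_definition teps :: "'n::finite trunc_poly" (\<open>\<epsilon>\<close>)
  is "\<lambda>i. if i = 1 \<and> 1 < CARD('n) then 1 else 0" by auto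

lemma tcoeff_teps_power:
  "tcoeff (\<epsilon> ^ k :: 'n::finite trunc_poly) i = (if i = k \<and> k < CARD('n) then 1 else 0)"
proof (induction k arbitrary: i)
  case 0
  show ?case by (simp add: one_trunc_poly.rep_eq)
next
  case (Suc k)
  have e: "tcoeff (\<epsilon> :: 'n trunc_poly) j = (if j = 1 \<and> 1 < CARD('n) then 1 else 0)" for j
    by transfer simp
  have "tcoeff (\<epsilon> ^ Suc k :: 'n trunc_poly) i =
      (if i < CARD('n) then \<Sum>j=0..i. tcoeff (\<epsilon> :: 'n trunc_poly) j * tcoeff (\<epsilon> ^ k :: 'n trunc_poly) (i - j) else 0)"
    unfolding power_Suc by (simp add: times_trunc_poly.rep_eq)
  also have "\<dots> = (if i < CARD('n) \<and> 1 \<le> i then tcoeff (\<epsilon> ^ k :: 'n trunc_poly) (i - 1) else 0)"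
  proof -
    have "(\<Sum>j=0..i. tcoeff (\<epsilon> :: 'n trunc_poly) j * tcoeff (\<epsilon> ^ k :: 'n trunc_poly) (i - j)) =
        (\<Sum>j=0..i. if j = 1 then (if 1 < CARD('n) then tcoeff (\<epsilon> ^ k :: 'n trunc_poly) (i - 1) else 0) else 0)"
      by (rule sum.cong) (auto simp: e)
    then show ?thesis by auto
  qed
  also have "\<dots> = (if i = Suc k \<and> Suc k < CARD('n) then 1 else 0)"
    unfolding Suc.IH by auto
  finally show ?case .
qed

lemma teps_power_mult:
  "(\<epsilon> ^ i * \<epsilon> ^ j :: 'n::finite trunc_poly) = (if i + j < CARD('n) then \<epsilon> ^ (i + j) else 0)"
  by (rule trunc_poly_eqI)
     (simp add: power_add[symmetric] tcoeff_teps_power zero_trunc_poly.rep_eq)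

lemma tcoeff_sum: "tcoeff (\<Sum>k\<in>K. f k) i = (\<Sum>k\<in>K. tcoeff (f k) i)"
  by (induction K rule: infinite_finite_induct)
     (simp_all add: zero_trunc_poly.rep_eq plus_trunc_poly.rep_eq)

lemma trunc_poly_expansion:
  "(p :: 'n::finite trunc_poly) = (\<Sum>i<CARD('n). tcoeff p i *\<^sub>R \<epsilon> ^ i)"
proof (rule trunc_poly_eqI)
  fix i assume i: "i < CARD('n)"
  have "tcoeff (\<Sum>k<CARD('n). tcoeff p k *\<^sub>R (\<epsilon> :: 'n trunc_poly) ^ k) i =
      (\<Sum>k<CARD('n). if k = i then tcoeff p k else 0)"
    unfolding tcoeff_sum
    by (rule sum.cong) (auto simp: scaleR_trunc_poly.rep_eq tcoeff_teps_power)
  also have "\<dots> = tcoeff p i"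
    using i by simp
  finally show "tcoeff p i = tcoeff (\<Sum>k<CARD('n). tcoeff p k *\<^sub>R (\<epsilon> :: 'n trunc_poly) ^ k) i"
    by (rule sym)
qed


section \<open>Functions with a domain\<close>

text \<open>
  A function defined on a subset \<open>X\<close> of a type is a partial map \<open>f\<close> with \<open>dom f = X\<close>.
  Sums and products of partial maps live on the intersection of the domains.
\<close>

definition pm_plus :: "('x \<rightharpoonup> 'a::plus) \<Rightarrow> ('x \<rightharpoonup> 'a) \<Rightarrow> ('x \<rightharpoonup> 'a)"  (infixl \<open>+\<^sub>m\<close> 65)
  where "f +\<^sub>m g = (\<lambda>x. if x \<in> dom f \<inter> dom g then Some (the (f x) + the (g x)) else None)"

definition pm_times :: "('x \<rightharpoonup> 'a::times) \<Rightarrow> ('x \<rightharpoonup> 'a) \<Rightarrow> ('x \<rightharpoonup> 'a)"  (infixl \<open>*\<^sub>m\<close> 70)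
  where "f *\<^sub>m g = (\<lambda>x. if x \<in> dom f \<inter> dom g then Some (the (f x) * the (g x)) else None)"

definition pm_scale :: "real \<Rightarrow> ('x \<rightharpoonup> 'a::real_vector) \<Rightarrow> ('x \<rightharpoonup> 'a)"  (infixr \<open>*\<^sub>s\<close> 75)
  where "r *\<^sub>s f = (\<lambda>x. if x \<in> dom f then Some (r *\<^sub>R the (f x)) else None)"

definition fun_space :: "'x set \<Rightarrow> ('x \<rightharpoonup> 'a) set"
  where "fun_space S = {h. dom h = S}"

text \<open>Open intervals may be unbounded.\<close>

definition open_interval :: "real set \<Rightarrow> bool"
  where "open_interval I \<longleftrightarrow> open I \<and> is_interval I \<and> I \<noteq> {}"


section \<open>Differentiable and analytic functions\<close>

text \<open>
  The existence of an \<open>n\<close>-th derivative at \<open>x\<close> requires that the derivative of order \<open>n - 1\<close>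
  exists in a neighbourhood of \<open>x\<close> and is differentiable at \<open>x\<close>.
\<close>

fun has_nth_deriv_at :: "nat \<Rightarrow> (real \<Rightarrow> real) \<Rightarrow> real \<Rightarrow> bool" where
  "has_nth_deriv_at 0 h x \<longleftrightarrow> True"
| "has_nth_deriv_at (Suc n) h x \<longleftrightarrow>
     (\<forall>\<^sub>F y in nhds x. has_nth_deriv_at n h y) \<and> (deriv ^^ n) h field_differentiable (at x)"

text \<open>
  The values of \<open>the \<circ> f\<close> outside \<open>dom f\<close> are irrelevant below, since derivatives are only taken
  at points of the open set \<open>dom f\<close>.
\<close>

definition nth_deriv :: "nat \<Rightarrow> (real \<rightharpoonup> real) \<Rightarrow> real \<Rightarrow> real"
  where "nth_deriv k f x = (deriv ^^ k) (\<lambda>y. the (f y)) x"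

definition D_space :: "nat \<Rightarrow> real \<Rightarrow> (real \<rightharpoonup> real) set"
  where "D_space n x =
    {f. open_interval (dom f) \<and> x \<in> dom f \<and> has_nth_deriv_at n (\<lambda>y. the (f y)) x}"

text \<open>
  Real analyticity means local expansion into a power series; the library's \<open>analytic_on\<close>
  would, at type \<open>real\<close>, only express differentiability.
\<close>

definition real_analytic_on :: "(real \<rightharpoonup> real) \<Rightarrow> real set \<Rightarrow> bool"
  where "real_analytic_on f I \<longleftrightarrow>
    I \<subseteq> dom f \<and> (\<forall>y\<in>I. \<exists>F. (\<lambda>h. the (f (y + h))) has_fps_expansion F)"

definition D_infinity :: "real \<Rightarrow> real \<Rightarrow> (real \<rightharpoonup> real) set"
  where "D_infinity a b =
    {f. open_interval (dom f) \<and> (\<exists>I. open_interval I \<and> {a..b} \<subseteq> I \<and> real_analytic_on f I)}"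

definition taylor_poly :: "nat \<Rightarrow> real \<Rightarrow> (real \<rightharpoonup> real) \<Rightarrow> real \<Rightarrow> real"
  where "taylor_poly n c f x = (\<Sum>i=0..n. nth_deriv i f c / fact i * (x - c) ^ i)"


section \<open>Automatic integration\<close>

text \<open>
  \<open>\<Lambda> x f\<close> is \<open>\<Lambda>(f)\<close> taken relative to the point \<open>x\<close>, and \<open>S x\<close> is the set \<open>A\<^sub>x\<close>.  A composite
  \<open>f \<circ>\<^sub>m g\<close> need not be defined on an interval, so the composition rule is demanded for its
  restriction to every open interval around \<open>x\<close> on which it is defined.
\<close>

definition automatic_integration_on ::
  "(real \<Rightarrow> 'a set) \<Rightarrow> nat \<Rightarrow> real \<Rightarrow> real \<Rightarrow> real \<Rightarrow>
   (real \<Rightarrow> (real \<rightharpoonup> real) \<Rightarrow> ('a \<rightharpoonup> 'a)) \<Rightarrow> (real \<Rightarrow> 'a) \<Rightarrow> ('a::real_algebra_1 \<Rightarrow> real) \<Rightarrow> bool"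
  where "automatic_integration_on S n a b c \<Lambda> \<Omega> \<Gamma> \<longleftrightarrow>
    0 < n \<and> a \<le> b \<and> c \<in> {a..b} \<and>
    (\<forall>x. \<Omega> x \<in> S x \<and> \<Lambda> x ` D_space n x \<subseteq> fun_space (S x) \<and>
         (\<forall>f\<in>D_space n x. \<forall>g\<in>D_space n x. \<Lambda> x (f +\<^sub>m g) = \<Lambda> x f +\<^sub>m \<Lambda> x g) \<and>
         (\<forall>r. \<forall>f\<in>D_space n x. \<Lambda> x (r *\<^sub>s f) = r *\<^sub>s \<Lambda> x f)) \<and>
    (\<forall>x. \<forall>f\<in>D_space n x. \<forall>g\<in>D_space n x.
         \<Lambda> x (f *\<^sub>m g) (\<Omega> x) = (\<Lambda> x f *\<^sub>m \<Lambda> x g) (\<Omega> x)) \<and>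
    (\<forall>x. \<forall>g\<in>D_space n x. \<forall>f\<in>D_space n (the (g x)).
         ran (\<Lambda> x g) \<subseteq> S (the (g x)) \<and>
         (\<forall>I. open_interval I \<and> x \<in> I \<and> I \<subseteq> dom (f \<circ>\<^sub>m g) \<longrightarrow>
            \<Lambda> x ((f \<circ>\<^sub>m g) |` I) (\<Omega> x) = (\<Lambda> (the (g x)) f \<circ>\<^sub>m \<Lambda> x g) (\<Omega> x))) \<and>
    (\<forall>f\<in>D_infinity a b.
         map_option \<Gamma> (\<Lambda> c f (\<Omega> c)) = Some (integral {a..b} (taylor_poly n c f)))"

definition automatic_integration ::
  "nat \<Rightarrow> real \<Rightarrow> real \<Rightarrow> real \<Rightarrow>
   (real \<Rightarrow> (real \<rightharpoonup> real) \<Rightarrow> ('a \<rightharpoonup> 'a)) \<Rightarrow> (real \<Rightarrow> 'a) \<Rightarrow> ('a::real_algebra_1 \<Rightarrow> real) \<Rightarrow> bool"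
  where "automatic_integration n a b c \<Lambda> \<Omega> \<Gamma> \<longleftrightarrow>
    (\<exists>S. automatic_integration_on S n a b c \<Lambda> \<Omega> \<Gamma>)"


section \<open>The three maps for the algebra of dimension 6\<close>

definition fiber6 :: "real \<Rightarrow> 6 trunc_poly set"
  where "fiber6 x = {of_real x + (\<Sum>i=1..5. \<alpha> i *\<^sub>R \<epsilon> ^ i) | \<alpha> :: nat \<Rightarrow> real. True}"

text \<open>
  The argument is \<open>u = x + (\<Sum>i=1..5. \<alpha> i *\<^sub>R \<epsilon> ^ i)\<close>.
\<close>

definition Lambda6 :: "real \<Rightarrow> (real \<rightharpoonup> real) \<Rightarrow> (6 trunc_poly \<rightharpoonup> 6 trunc_poly)"
  where "Lambda6 x f = (\<lambda>u. if u \<in> fiber6 x then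
    (let \<alpha> = tcoeff u; d = (\<lambda>k. nth_deriv k f x) in Some (
       of_real (the (f x))
     + (\<alpha> 1 * d 1) *\<^sub>R \<epsilon>
     + (\<alpha> 2 * d 1 + 1 / fact 2 * \<alpha> 1 ^ 2 * d 2) *\<^sub>R \<epsilon> ^ 2
     + (\<alpha> 3 * d 1 + \<alpha> 1 * \<alpha> 2 * d 2 + 1 / fact 3 * \<alpha> 1 ^ 3 * d 3) *\<^sub>R \<epsilon> ^ 3
     + (\<alpha> 4 * d 1 + (\<alpha> 1 * \<alpha> 3 + 1 / 2 * \<alpha> 2 ^ 2) * d 2 + 1 / 2 * \<alpha> 1 ^ 2 * \<alpha> 2 * d 3
          + 1 / fact 4 * \<alpha> 1 ^ 4 * d 4) *\<^sub>R \<epsilon> ^ 4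
     + (\<alpha> 5 * d 1 + (\<alpha> 1 * \<alpha> 4 + \<alpha> 2 * \<alpha> 3) * d 2
          + 1 / 2 * (\<alpha> 1 ^ 2 * \<alpha> 3 + \<alpha> 1 * \<alpha> 2 ^ 2) * d 3
          + 1 / 6 * \<alpha> 1 ^ 3 * \<alpha> 2 * d 4 + 1 / fact 5 * \<alpha> 1 ^ 5 * d 5) *\<^sub>R \<epsilon> ^ 5))
    else None)"

definition Omega6 :: "(nat \<Rightarrow> real) \<Rightarrow> real \<Rightarrow> 6 trunc_poly"
  where "Omega6 \<beta> x = of_real x + (\<Sum>i=1..5. \<beta> i *\<^sub>R \<epsilon> ^ i)"

definition Gamma6 :: "real \<Rightarrow> real \<Rightarrow> (nat \<Rightarrow> real) \<Rightarrow> 6 trunc_poly \<Rightarrow> real"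
  where "Gamma6 a b A y = (b - a) * tcoeff y 0 + (\<Sum>i=1..5. A i * tcoeff y i)"

end

theory Submission
  imports Defs
begin

text \<open>
  Write \<open>N = u - x\<close> for the nilpotent part of a point \<open>u\<close> of the fibre over \<open>x\<close>.  The long formula
  defining \<open>\<Lambda>\<close> is nothing but Taylor's formula \<open>\<Lambda>(f)(u) = (\<Sum>k\<le>5. f\<^sup>(\<^sup>k\<^sup>) x / k! \<cdot> N ^ k)\<close>, expanded with
  \<open>\<epsilon> ^ 6 = 0\<close>.  In terms of formal power series: \<open>\<Lambda>(f)(u)\<close> is the truncation of the jet of \<open>f\<close> at
  \<open>x\<close>, composed with \<open>N\<close> (\<open>Lambda6_eq_compose\<close>).

  The algebraic axioms then split into a statement on jets and one on formal power series.  Jets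
  of sums, products and composites of functions are the formal sums, products and composites of
  the jets (\<open>has_jet_add\<close>, \<open>has_jet_mult\<close>, \<open>has_jet_compose\<close>); each of these is proved by induction
  on the order, since the formal derivative of a jet is the jet of the derivative and formal power
  series obey the same product and chain rules as functions.  This replaces the explicit
  combinatorics of higher derivatives of products and composites.  On the formal side, composition
  from the right with \<open>N\<close> is an algebra homomorphism, which gives linearity and multiplicativity of
  \<open>\<Lambda>\<close>, and formal composition is associative, which gives the rule for \<open>\<Lambda>(f \<circ> g)\<close>.

  For the integral, \<open>\<Gamma>(\<Lambda>(f)(\<Omega>(c)))\<close> is by linearity the sum of \<open>f\<^sup>(\<^sup>k\<^sup>) c / k! \<cdot> \<Gamma>(N ^ k)\<close>, with
  \<open>N = \<Omega>(c) - c\<close>.  It equals the integral of the Taylor polynomial as soon as \<open>\<Gamma>(N ^ k)\<close> is the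
  integral of \<open>(x - c) ^ k\<close> over the interval for \<open>k = 0, \<dots>, 5\<close>.  These equations form a triangular
  linear system for the weights of \<open>\<Gamma>\<close>, with the powers of \<open>\<beta> 1\<close> on the diagonal, and the
  recursion for \<open>A 5, \<dots>, A 1\<close> solves it (\<open>Gamma6_moments\<close>).
\<close>

section \<open>Jets of real functions\<close>

lemma frequently_nhds_eq: "\<exists>\<^sub>F y in nhds x. y = x"
  unfolding frequently_def
proof
  assume "\<forall>\<^sub>F y in nhds x. y \<noteq> x"
  from eventually_nhds_x_imp_x[OF this] show False by simp
qed

text \<open>
  The definition peels derivatives off at the outer end, whereas the product and chain rules
  describe the first derivative; this lemma exchanges the two.  The disjunction \<open>y = x \<or> n \<noteq> 0\<close>
  lets one formula cover both cases: for \<open>n = 0\<close> differentiability is required at \<open>x\<close> alone, and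
  otherwise in a whole neighbourhood.
\<close>

lemma has_nth_deriv_at_Suc_iff:
  "has_nth_deriv_at (Suc n) f x \<longleftrightarrow>
     (\<forall>\<^sub>F y in nhds x. y = x \<or> n \<noteq> 0 \<longrightarrow> f field_differentiable (at y)) \<and>
     has_nth_deriv_at n (deriv f) x"
proof (induction n arbitrary: x)
  case 0
  have "has_nth_deriv_at 0 f = (\<lambda>_. True)"
    by (rule ext) simp
  then show ?case
    by (simp add: frequently_nhds_eq)
next
  case (Suc n)
  have der: "(deriv ^^ Suc n) f = (deriv ^^ n) (deriv f)"
    by (simp add: funpow_Suc_right del: funpow.simps)
  have near: "(\<forall>\<^sub>F y in nhds x. has_nth_deriv_at (Suc n) f y) \<longleftrightarrow>
      (\<forall>\<^sub>F y in nhds x. f field_differentiable (at y)) \<and>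
      (\<forall>\<^sub>F y in nhds x. has_nth_deriv_at n (deriv f) y)"
  proof -
    have "(\<forall>\<^sub>F y in nhds x. \<forall>\<^sub>F z in nhds y. z = y \<or> n \<noteq> 0 \<longrightarrow> f field_differentiable (at z)) \<longleftrightarrow>
        (\<forall>\<^sub>F y in nhds x. f field_differentiable (at y))"
    proof
      assume "\<forall>\<^sub>F y in nhds x. \<forall>\<^sub>F z in nhds y. z = y \<or> n \<noteq> 0 \<longrightarrow> f field_differentiable (at z)"
      then show "\<forall>\<^sub>F y in nhds x. f field_differentiable (at y)"
        by (rule eventually_mono) (auto dest: eventually_nhds_x_imp_x)
    next
      assume "\<forall>\<^sub>F y in nhds x. f field_differentiable (at y)"
      then have "\<forall>\<^sub>F y in nhds x. \<forall>\<^sub>F z in nhds y. f field_differentiable (at z)"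
        by (simp add: eventually_eventually)
      then show "\<forall>\<^sub>F y in nhds x. \<forall>\<^sub>F z in nhds y. z = y \<or> n \<noteq> 0 \<longrightarrow> f field_differentiable (at z)"
        by (auto elim!: eventually_mono)
    qed
    then show ?thesis
      unfolding Suc.IH eventually_conj_iff by blast
  qed
  show ?case
    unfolding has_nth_deriv_at.simps(2)[of "Suc n" f x] near der has_nth_deriv_at.simps(2)[of n "deriv f" x]
    by auto
qed

text \<open>
  \<open>F\<close> is a formal power series whose part of order at most \<open>n\<close> is the Taylor expansion of \<open>f\<close>
  at \<open>x\<close>.  Its higher coefficients are left free, so that sums, products and compositions of jets
  can be formed in the ring of formal power series, without any truncation.
\<close>

definition has_jet :: "nat \<Rightarrow> (real \<Rightarrow> real) \<Rightarrow> real \<Rightarrow> real fps \<Rightarrow> bool"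
  where "has_jet n f x F \<longleftrightarrow>
    has_nth_deriv_at n f x \<and> (\<forall>k\<le>n. (deriv ^^ k) f x = fact k * fps_nth F k)"

lemma has_jet_0: "has_jet 0 f x F \<longleftrightarrow> fps_nth F 0 = f x"
  by (auto simp: has_jet_def)

text \<open>
  The formal derivative of the jet of \<open>f\<close> is the jet of \<open>f'\<close>.  A jet of order \<open>n + 1\<close> is thus
  determined by its constant term and a jet of order \<open>n\<close>, which is what makes all the calculus
  rules below follow by induction on the order from their first-order versions.
\<close>

lemma has_jet_Suc:
  "has_jet (Suc n) f x F \<longleftrightarrow> fps_nth F 0 = f x \<and>
     (\<forall>\<^sub>F y in nhds x. y = x \<or> n \<noteq> 0 \<longrightarrow> f field_differentiable (at y)) \<and>
     has_jet n (deriv f) x (fps_deriv F)"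
proof -
  have "(\<forall>k\<le>Suc n. (deriv ^^ k) f x = fact k * fps_nth F k) \<longleftrightarrow>
      fps_nth F 0 = f x \<and> (\<forall>k\<le>n. (deriv ^^ Suc k) f x = fact (Suc k) * fps_nth F (Suc k))"
    by (subst atMost_iff[symmetric], subst atMost_Suc_eq_insert_0) auto
  then show ?thesis
    unfolding has_jet_def has_nth_deriv_at_Suc_iff
    by (auto simp: funpow_Suc_right mult_ac simp del: funpow.simps)
qed

lemma has_jet_value: "has_jet n f x F \<Longrightarrow> fps_nth F 0 = f x"
  by (cases n) (auto simp: has_jet_0 has_jet_Suc)

lemma has_jet_exists:
  "has_nth_deriv_at n f x \<Longrightarrow> has_jet n f x (Abs_fps (\<lambda>k. (deriv ^^ k) f x / fact k))"
  by (simp add: has_jet_def)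

lemma has_jet_lower: "has_jet (Suc n) f x F \<Longrightarrow> has_jet n f x F"
  by (auto simp: has_jet_def dest: eventually_nhds_x_imp_x)

lemma has_jet_cong:
  assumes "\<forall>\<^sub>F y in nhds x. y = x \<or> n \<noteq> 0 \<longrightarrow> f y = g y" and "has_jet n f x F"
  shows "has_jet n g x F"
  using assms
proof (induction n arbitrary: f g F)
  case 0
  then show ?case by (simp add: has_jet_0 frequently_nhds_eq)
next
  case (Suc n)
  from Suc.prems(1) have eq: "\<forall>\<^sub>F y in nhds x. f y = g y" by simp
  then have near: "\<forall>\<^sub>F y in nhds x. \<forall>\<^sub>F z in nhds y. f z = g z"
    by (simp add: eventually_eventually)
  from near have "\<forall>\<^sub>F y in nhds x. y = x \<or> n \<noteq> 0 \<longrightarrow> deriv f y = deriv g y"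
    by (rule eventually_mono) (simp add: deriv_cong_ev)
  then have "has_jet n (deriv g) x (fps_deriv F)"
    by (rule Suc.IH) (use Suc.prems(2) in \<open>simp add: has_jet_Suc\<close>)
  moreover have "\<forall>\<^sub>F y in nhds x. y = x \<or> n \<noteq> 0 \<longrightarrow> g field_differentiable (at y)"
    using near Suc.prems(2)[unfolded has_jet_Suc, THEN conjunct2, THEN conjunct1]
  proof eventually_elim
    case (elim y)
    have "g field_differentiable (at y)" if "f field_differentiable (at y)"
      using that DERIV_cong_ev[OF refl elim(1) refl] by (auto simp: field_differentiable_def)
    then show ?case using elim(2) by blast
  qed
  ultimately show ?case
    using Suc.prems(2) eventually_nhds_x_imp_x[OF eq] by (simp add: has_jet_Suc)
qed

lemma has_jet_Suc_intro:
  assumes "fps_nth F 0 = f x"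
    and "\<forall>\<^sub>F y in nhds x. y = x \<or> n \<noteq> 0 \<longrightarrow> (f has_field_derivative f' y) (at y)"
    and "has_jet n f' x (fps_deriv F)"
  shows "has_jet (Suc n) f x F"
proof -
  have "has_jet n (deriv f) x (fps_deriv F)"
    by (rule has_jet_cong[OF _ assms(3)], rule eventually_mono[OF assms(2)]) (metis DERIV_imp_deriv)
  moreover have "\<forall>\<^sub>F y in nhds x. y = x \<or> n \<noteq> 0 \<longrightarrow> f field_differentiable (at y)"
    by (rule eventually_mono[OF assms(2)]) (auto simp: field_differentiable_def)
  ultimately show ?thesis using assms(1) by (simp add: has_jet_Suc)
qed

lemma has_jet_SucD:
  assumes "has_jet (Suc n) f x F"
  shows "\<forall>\<^sub>F y in nhds x. y = x \<or> n \<noteq> 0 \<longrightarrow> (f has_field_derivative deriv f y) (at y)"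
    and "has_jet n (deriv f) x (fps_deriv F)"
  using assms unfolding has_jet_Suc
  by (auto elim!: eventually_mono simp: DERIV_deriv_iff_field_differentiable)

lemma has_jet_const: "has_jet n (\<lambda>_. r) x (fps_const r)"
proof (induction n arbitrary: r)
  case 0
  show ?case by (simp add: has_jet_0)
next
  case (Suc n)
  show ?case
    by (rule has_jet_Suc_intro[where f' = "\<lambda>_. 0"]) (use Suc[of 0] in auto)
qed

lemma has_jet_add:
  assumes "has_jet n f x F" and "has_jet n g x G"
  shows "has_jet n (\<lambda>y. f y + g y) x (F + G)"
  using assms
proof (induction n arbitrary: f g F G)
  case 0
  then show ?case by (simp add: has_jet_0)
next
  case (Suc n)
  note f = has_jet_SucD[OF Suc.prems(1)] and g = has_jet_SucD[OF Suc.prems(2)]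
  show ?case
  proof (rule has_jet_Suc_intro)
    show "fps_nth (F + G) 0 = f x + g x"
      using Suc.prems[THEN has_jet_value] by simp
    show "\<forall>\<^sub>F y in nhds x. y = x \<or> n \<noteq> 0 \<longrightarrow>
        ((\<lambda>y. f y + g y) has_field_derivative deriv f y + deriv g y) (at y)"
      using f(1) g(1) by eventually_elim (auto intro: DERIV_add)
    show "has_jet n (\<lambda>y. deriv f y + deriv g y) x (fps_deriv (F + G))"
      using Suc.IH[OF f(2) g(2)] by simp
  qed
qed

text \<open>
  The Leibniz formula of every order: the product rule for functions and that for formal power
  series agree.
\<close>

lemma has_jet_mult:
  assumes "has_jet n f x F" and "has_jet n g x G"
  shows "has_jet n (\<lambda>y. f y * g y) x (F * G)"
  using assms
proof (induction n arbitrary: f g F G)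
  case 0
  then show ?case by (simp add: has_jet_0)
next
  case (Suc n)
  note f = has_jet_SucD[OF Suc.prems(1)] and g = has_jet_SucD[OF Suc.prems(2)]
  show ?case
  proof (rule has_jet_Suc_intro)
    show "fps_nth (F * G) 0 = f x * g x"
      using Suc.prems[THEN has_jet_value] by simp
    show "\<forall>\<^sub>F y in nhds x. y = x \<or> n \<noteq> 0 \<longrightarrow>
        ((\<lambda>y. f y * g y) has_field_derivative f y * deriv g y + deriv f y * g y) (at y)"
      using f(1) g(1) by eventually_elim (auto intro: DERIV_mult')
    show "has_jet n (\<lambda>y. f y * deriv g y + deriv f y * g y) x (fps_deriv (F * G))"
      unfolding fps_deriv_mult
      by (intro has_jet_add Suc.IH f g Suc.prems[THEN has_jet_lower])
  qed
qed

text \<open>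
  This is Faa di Bruno's formula.  Its combinatorics is hidden in formal composition: both sides
  have the same value, and their derivatives are \<open>(f' \<circ> g) \<cdot> g'\<close> in either world, where \<open>f' \<circ> g\<close>
  is covered by the induction hypothesis.
\<close>

lemma has_jet_compose:
  assumes "has_jet n f (g x) F" and "has_jet n g x G"
  shows "has_jet n (\<lambda>y. f (g y)) x (F oo (G - fps_const (g x)))"
  using assms
proof (induction n arbitrary: f F)
  case 0
  then show ?case by (simp add: has_jet_0)
next
  case (Suc n)
  note f = has_jet_SucD[OF Suc.prems(1)] and g = has_jet_SucD[OF Suc.prems(2)]
  let ?G = "G - fps_const (g x)"
  show ?case
  proof (rule has_jet_Suc_intro)
    show "fps_nth (F oo ?G) 0 = f (g x)"
      using Suc.prems[THEN has_jet_value] by simp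
    \<comment> \<open>Continuity of \<open>g\<close> carries the information on \<open>f\<close> near \<open>g x\<close> over to points near \<open>x\<close>.\<close>
    have "(g has_field_derivative deriv g x) (at x)"
      using eventually_nhds_x_imp_x[OF g(1)] by simp
    then have "filterlim g (nhds (g x)) (nhds x)"
      using DERIV_isCont continuous_at by (metis isCont_def tendsto_nhds_iff)
    from eventually_compose_filterlim[OF f(1) this] g(1)
    show "\<forall>\<^sub>F y in nhds x. y = x \<or> n \<noteq> 0 \<longrightarrow>
        ((\<lambda>y. f (g y)) has_field_derivative deriv f (g y) * deriv g y) (at y)"
      by eventually_elim (auto intro: DERIV_chain2)
    have "fps_nth ?G 0 = 0" using has_jet_value[OF Suc.prems(2)] by simp
    then have "fps_deriv (F oo ?G) = (fps_deriv F oo ?G) * fps_deriv G"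
      by (simp add: fps_compose_deriv)
    moreover have "has_jet n (\<lambda>y. deriv f (g y)) x (fps_deriv F oo ?G)"
      by (rule Suc.IH[OF f(2) has_jet_lower[OF Suc.prems(2)]])
    ultimately show "has_jet n (\<lambda>y. deriv f (g y) * deriv g y) x (fps_deriv (F oo ?G))"
      using has_jet_mult g(2) by simp
  qed
qed

lemma D_space_has_jet:
  assumes "f \<in> D_space n x"
  obtains F where "has_jet n (\<lambda>y. the (f y)) x F"
  using assms has_jet_exists unfolding D_space_def by blast

lemma D_space_eventually_dom:
  assumes "f \<in> D_space n x"
  shows "\<forall>\<^sub>F y in nhds x. y \<in> dom f"
  using assms unfolding D_space_def open_interval_def by (auto intro: eventually_nhds_in_open)

lemma has_jet_cong_near:
  assumes "has_jet n f x F" and "\<forall>\<^sub>F y in nhds x. f y = g y"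
  shows "has_jet n g x F"
  by (rule has_jet_cong[OF _ assms(1)], rule eventually_mono[OF assms(2)]) simp

lemma has_jet_pm_plus:
  assumes "f \<in> D_space n x" "g \<in> D_space n x"
    and "has_jet n (\<lambda>y. the (f y)) x F" "has_jet n (\<lambda>y. the (g y)) x G"
  shows "has_jet n (\<lambda>y. the ((f +\<^sub>m g) y)) x (F + G)"
  by (rule has_jet_cong_near[OF has_jet_add[OF assms(3,4)]])
     (use D_space_eventually_dom[OF assms(1)] D_space_eventually_dom[OF assms(2)] in
       \<open>eventually_elim, simp add: pm_plus_def\<close>)

lemma has_jet_pm_times:
  assumes "f \<in> D_space n x" "g \<in> D_space n x"
    and "has_jet n (\<lambda>y. the (f y)) x F" "has_jet n (\<lambda>y. the (g y)) x G"
  shows "has_jet n (\<lambda>y. the ((f *\<^sub>m g) y)) x (F * G)"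
  by (rule has_jet_cong_near[OF has_jet_mult[OF assms(3,4)]])
     (use D_space_eventually_dom[OF assms(1)] D_space_eventually_dom[OF assms(2)] in
       \<open>eventually_elim, simp add: pm_times_def\<close>)

lemma has_jet_pm_scale:
  assumes "f \<in> D_space n x" and "has_jet n (\<lambda>y. the (f y)) x F"
  shows "has_jet n (\<lambda>y. the ((r *\<^sub>s f) y)) x (fps_const r * F)"
  by (rule has_jet_cong_near[OF has_jet_mult[OF has_jet_const assms(2)]])
     (use D_space_eventually_dom[OF assms(1)] in \<open>eventually_elim, simp add: pm_scale_def\<close>)

lemma has_jet_map_comp_restrict:
  assumes "open_interval I" "x \<in> I" "I \<subseteq> dom (f \<circ>\<^sub>m g)"
    and "has_jet n (\<lambda>y. the (f y)) (the (g x)) F" "has_jet n (\<lambda>y. the (g y)) x G"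
  shows "has_jet n (\<lambda>y. the (((f \<circ>\<^sub>m g) |` I) y)) x (F oo (G - fps_const (the (g x))))"
proof (rule has_jet_cong_near[OF has_jet_compose])
  have "\<forall>\<^sub>F y in nhds x. y \<in> I"
    using assms(1,2) unfolding open_interval_def by (auto intro: eventually_nhds_in_open)
  then show "\<forall>\<^sub>F y in nhds x. the (f (the (g y))) = the (((f \<circ>\<^sub>m g) |` I) y)"
    by eventually_elim (use assms(3) in \<open>auto simp: map_comp_def split: option.splits\<close>)
qed (use assms in auto)

section \<open>Formal power series and truncated polynomials\<close>

text \<open>
  Coefficients up to \<open>n\<close> of powers, and hence of composites, depend only on coefficients up to
  \<open>n\<close> of the arguments.  Jets are therefore precise enough for computations modulo \<open>\<epsilon> ^ (n + 1)\<close>.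
\<close>

lemma fps_nth_power_cong:
  fixes F G :: "'a::comm_semiring_1 fps"
  assumes "\<And>i. i \<le> n \<Longrightarrow> fps_nth F i = fps_nth G i" and "i \<le> n"
  shows "fps_nth (F ^ m) i = fps_nth (G ^ m) i"
  using \<open>i \<le> n\<close>
proof (induction m arbitrary: i)
  case (Suc m)
  then show ?case
    using assms(1) by (simp add: fps_mult_nth)
qed simp

lemma fps_nth_compose_cong:
  fixes F F' G G' :: "'a::comm_semiring_1 fps"
  assumes "\<And>i. i \<le> n \<Longrightarrow> fps_nth F i = fps_nth F' i"
    and "\<And>i. i \<le> n \<Longrightarrow> fps_nth G i = fps_nth G' i"
  shows "fps_nth (F oo G) n = fps_nth (F' oo G') n"
  unfolding fps_compose_nth
  by (rule sum.cong) (use assms fps_nth_power_cong[OF assms(2)] in auto)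

text \<open>
  The quotient map from formal power series onto the truncated polynomial algebra.
\<close>

lift_definition trunc_fps :: "real fps \<Rightarrow> 'n::finite trunc_poly"
  is "\<lambda>F i. if i < CARD('n) then fps_nth F i else 0" by simp

lemma trunc_fps_add: "trunc_fps (F + G) = trunc_fps F + trunc_fps G"
  by transfer auto

lemma trunc_fps_mult: "trunc_fps (F * G) = (trunc_fps F * trunc_fps G :: 'n::finite trunc_poly)"
  by (rule trunc_poly_eqI)
     (auto simp: times_trunc_poly.rep_eq trunc_fps.rep_eq fps_mult_nth intro!: sum.cong)

lemma trunc_fps_const_mult: "trunc_fps (fps_const r * F) = r *\<^sub>R trunc_fps F"
  by transfer auto

lemma trunc_fps_cong:
  assumes "\<And>i. i < CARD('n) \<Longrightarrow> fps_nth F i = fps_nth G i"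
  shows "(trunc_fps F :: 'n::finite trunc_poly) = trunc_fps G"
  by (rule trunc_poly_eqI) (simp add: trunc_fps.rep_eq assms)

text \<open>
  The value is a power series rather than an element of the algebra, so that it can be
  substituted into jets; its constant term vanishes, as formal composition requires.
\<close>

definition nilpotent_part :: "'n trunc_poly \<Rightarrow> real fps"
  where "nilpotent_part u = Abs_fps (\<lambda>i. if i = 0 then 0 else tcoeff u i)"

lemma nilpotent_part_nth: "fps_nth (nilpotent_part u) i = (if i = 0 then 0 else tcoeff u i)"
  by (simp add: nilpotent_part_def)

text \<open>
  Passing to the truncated algebra in the middle of a composition loses nothing.  This reduces
  the associativity needed for the chain rule to associativity of formal composition.
\<close>

lemma trunc_fps_compose:
  "trunc_fps (F oo nilpotent_part (trunc_fps G :: 'n::finite trunc_poly)) =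
   (trunc_fps (F oo (G - fps_const (fps_nth G 0))) :: 'n trunc_poly)"
  by (intro trunc_fps_cong fps_nth_compose_cong)
     (auto simp: nilpotent_part_nth trunc_fps.rep_eq)

lemma tcoeff_of_real: "tcoeff (of_real r :: 'n::finite trunc_poly) i = (if i = 0 then r else 0)"
  by (simp add: of_real_def scaleR_trunc_poly.rep_eq one_trunc_poly.rep_eq)

lemma tcoeff_teps:
  "tcoeff (\<epsilon> :: 'n::finite trunc_poly) i = (if i = 1 \<and> 1 < CARD('n) then 1 else 0)"
  using tcoeff_teps_power[of 1 i, where 'n = 'n] by simp

text \<open>
  The coefficients of \<open>\<Sum>m. F\<^sub>m N ^ m\<close>, obtained by expanding the powers of \<open>N\<close> one factor at a
  time.  Since \<open>N ^ m\<close> starts in degree \<open>m\<close>, only finitely many powers contribute.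
\<close>

lemma fps_compose_nth_low:
  fixes F N :: "real fps"
  assumes N0: "fps_nth N 0 = 0"
  defines "\<alpha> \<equiv> fps_nth N" and "\<phi> \<equiv> fps_nth F"
  shows "fps_nth (F oo N) 1 = \<alpha> 1 * \<phi> 1"
    and "fps_nth (F oo N) 2 = \<alpha> 2 * \<phi> 1 + \<alpha> 1 ^ 2 * \<phi> 2"
    and "fps_nth (F oo N) 3 = \<alpha> 3 * \<phi> 1 + 2 * \<alpha> 1 * \<alpha> 2 * \<phi> 2 + \<alpha> 1 ^ 3 * \<phi> 3"
    and "fps_nth (F oo N) 4 = \<alpha> 4 * \<phi> 1 + (2 * \<alpha> 1 * \<alpha> 3 + \<alpha> 2 ^ 2) * \<phi> 2
      + 3 * \<alpha> 1 ^ 2 * \<alpha> 2 * \<phi> 3 + \<alpha> 1 ^ 4 * \<phi> 4"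
    and "fps_nth (F oo N) 5 = \<alpha> 5 * \<phi> 1 + 2 * (\<alpha> 1 * \<alpha> 4 + \<alpha> 2 * \<alpha> 3) * \<phi> 2
      + 3 * (\<alpha> 1 ^ 2 * \<alpha> 3 + \<alpha> 1 * \<alpha> 2 ^ 2) * \<phi> 3 + 4 * \<alpha> 1 ^ 3 * \<alpha> 2 * \<phi> 4 + \<alpha> 1 ^ 5 * \<phi> 5"
proof -
  have low: "fps_nth (N ^ m) i = 0" if "i < m" for m i
    using startsby_zero_power_prefix[OF N0, of m] that by blast
  have power_step: "fps_nth (N ^ m) i = (\<Sum>j=1..i. \<alpha> j * fps_nth (N ^ (m - 1)) (i - j))"
    if "0 < m" for m i
  proof -
    have "N ^ m = N * N ^ (m - 1)"
      using that by (simp add: power_eq_if)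
    then show ?thesis
      by (simp add: fps_mult_nth sum.atLeast_Suc_atMost N0 \<alpha>_def)
  qed
  have from1: "{1..2} = {1, 2::nat}" "{1..3} = {1, 2, 3::nat}" "{1..4} = {1, 2, 3, 4::nat}"
     "{1..5} = {1, 2, 3, 4, 5::nat}" by auto
  have from0: "{0..1} = {0, 1::nat}" "{0..2} = {0, 1, 2::nat}" "{0..3} = {0, 1, 2, 3::nat}"
     "{0..4} = {0, 1, 2, 3, 4::nat}" "{0..5} = {0, 1, 2, 3, 4, 5::nat}" by auto
  have p1: "fps_nth N i = \<alpha> i" for i
    by (simp add: \<alpha>_def)
  have \<alpha>0: "\<alpha> 0 = 0"
    by (simp add: \<alpha>_def N0)
  have p2: "fps_nth (N ^ 2) 2 = \<alpha> 1 ^ 2" "fps_nth (N ^ 2) 3 = 2 * \<alpha> 1 * \<alpha> 2"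
    "fps_nth (N ^ 2) 4 = 2 * \<alpha> 1 * \<alpha> 3 + \<alpha> 2 ^ 2"
    "fps_nth (N ^ 2) 5 = 2 * (\<alpha> 1 * \<alpha> 4 + \<alpha> 2 * \<alpha> 3)"
    by (simp_all add: power_step[of 2] from1 p1 \<alpha>0
        power2_eq_square[where 'a = real] algebra_simps flip: One_nat_def)
  have p3: "fps_nth (N ^ 3) 3 = \<alpha> 1 ^ 3" "fps_nth (N ^ 3) 4 = 3 * \<alpha> 1 ^ 2 * \<alpha> 2"
    "fps_nth (N ^ 3) 5 = 3 * (\<alpha> 1 ^ 2 * \<alpha> 3 + \<alpha> 1 * \<alpha> 2 ^ 2)"
    by (simp_all add: power_step[of 3] from1 p2 low power2_eq_square[where 'a = real]
        power3_eq_cube[where 'a = real] algebra_simps flip: One_nat_def)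
  have p4: "fps_nth (N ^ 4) 4 = \<alpha> 1 ^ 4" "fps_nth (N ^ 4) 5 = 4 * \<alpha> 1 ^ 3 * \<alpha> 2"
    by (simp_all add: power_step[of 4] from1 p3 low power_numeral_reduce[where 'a = real] algebra_simps
        flip: One_nat_def)
  have p5: "fps_nth (N ^ 5) 5 = \<alpha> 1 ^ 5"
    by (simp add: power_step[of 5] from1 p4 low power_numeral_reduce[where 'a = real] algebra_simps
        flip: One_nat_def)
  note powers = p1 p2 p3 p4 p5
  show "fps_nth (F oo N) 1 = \<alpha> 1 * \<phi> 1"
    and "fps_nth (F oo N) 2 = \<alpha> 2 * \<phi> 1 + \<alpha> 1 ^ 2 * \<phi> 2"
    and "fps_nth (F oo N) 3 = \<alpha> 3 * \<phi> 1 + 2 * \<alpha> 1 * \<alpha> 2 * \<phi> 2 + \<alpha> 1 ^ 3 * \<phi> 3"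
    and "fps_nth (F oo N) 4 = \<alpha> 4 * \<phi> 1 + (2 * \<alpha> 1 * \<alpha> 3 + \<alpha> 2 ^ 2) * \<phi> 2
      + 3 * \<alpha> 1 ^ 2 * \<alpha> 2 * \<phi> 3 + \<alpha> 1 ^ 4 * \<phi> 4"
    and "fps_nth (F oo N) 5 = \<alpha> 5 * \<phi> 1 + 2 * (\<alpha> 1 * \<alpha> 4 + \<alpha> 2 * \<alpha> 3) * \<phi> 2
      + 3 * (\<alpha> 1 ^ 2 * \<alpha> 3 + \<alpha> 1 * \<alpha> 2 ^ 2) * \<phi> 3 + 4 * \<alpha> 1 ^ 3 * \<alpha> 2 * \<phi> 4 + \<alpha> 1 ^ 5 * \<phi> 5"
    by (simp_all add: fps_compose_nth from0 powers \<phi>_def algebra_simps flip: One_nat_def)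
qed

section \<open>The extension of functions as Taylor expansion\<close>

lemma tcoeff_teps_sum:
  "i < 6 \<Longrightarrow> tcoeff (of_real x + (\<Sum>k=1..5. \<alpha> k *\<^sub>R \<epsilon> ^ k) :: 6 trunc_poly) i =
    (if i = 0 then x else \<alpha> i)"
proof -
  assume i: "i < 6"
  have "tcoeff (\<Sum>k=1..5. \<alpha> k *\<^sub>R \<epsilon> ^ k :: 6 trunc_poly) i = (\<Sum>k=1..5. if k = i then \<alpha> k else 0)"
    unfolding tcoeff_sum by (rule sum.cong) (auto simp: scaleR_trunc_poly.rep_eq tcoeff_teps_power)
  then show ?thesis using i by (simp add: plus_trunc_poly.rep_eq tcoeff_of_real)
qed

lemma fiber6_eq: "fiber6 x = {u. tcoeff u 0 = x}"
proof (intro subset_antisym subsetI)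
  fix u assume "u \<in> fiber6 x"
  then show "u \<in> {u. tcoeff u 0 = x}"
    unfolding fiber6_def using tcoeff_teps_sum[of 0 x] by auto
next
  fix u :: "6 trunc_poly" assume u: "u \<in> {u. tcoeff u 0 = x}"
  have "u = of_real x + (\<Sum>k=1..5. tcoeff u k *\<^sub>R \<epsilon> ^ k)"
    by (rule trunc_poly_eqI) (use u in \<open>simp add: tcoeff_teps_sum del: One_nat_def\<close>)
  then show "u \<in> fiber6 x" unfolding fiber6_def by blast
qed

text \<open>
  The explicit formula for \<open>\<Lambda>\<close> is Taylor's formula with a nilpotent increment:
  \<open>\<Lambda>(f)(u) = (\<Sum>k. f\<^sup>(\<^sup>k\<^sup>) x / k! \<cdot> (u - x) ^ k)\<close>.  It turns each
  algebraic property of \<open>\<Lambda>\<close> into an identity between formal composites.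
\<close>

lemma Lambda6_eq_compose:
  assumes "has_jet 5 (\<lambda>y. the (f y)) x F"
  shows "Lambda6 x f u = (if u \<in> fiber6 x then Some (trunc_fps (F oo nilpotent_part u)) else None)"
proof (cases "u \<in> fiber6 x")
  case True
  let ?N = "nilpotent_part u"
  have f: "the (f x) = fps_nth F 0"
    using has_jet_value[OF assms] by simp
  have d: "nth_deriv k f x = fact k * fps_nth F k" if "k \<le> 5" for k
    using assms that by (simp add: has_jet_def nth_deriv_def)
  have N0: "fps_nth ?N 0 = 0" and N: "0 < i \<Longrightarrow> fps_nth ?N i = tcoeff u i" for i
    by (simp_all add: nilpotent_part_nth)
  have "the (Lambda6 x f u) = trunc_fps (F oo ?N)"
  proof (rule trunc_poly_eqI)
    fix i assume i: "i < CARD(6)"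
    then have "i = 0 \<or> i = 1 \<or> i = 2 \<or> i = 3 \<or> i = 4 \<or> i = 5" by auto
    moreover have "tcoeff (trunc_fps (F oo ?N) :: 6 trunc_poly) i = fps_nth (F oo ?N) i"
      using i by (simp add: trunc_fps.rep_eq)
    ultimately show "tcoeff (the (Lambda6 x f u)) i = tcoeff (trunc_fps (F oo ?N) :: 6 trunc_poly) i"
      by (elim disjE; simp add: True Lambda6_def Let_def plus_trunc_poly.rep_eq
          scaleR_trunc_poly.rep_eq tcoeff_of_real tcoeff_teps_power tcoeff_teps f d
          fps_compose_nth_low[OF N0] N fact_numeral field_simps flip: One_nat_def)
  qed
  with True show ?thesis
    by (auto simp: Lambda6_def Let_def)
qed (simp add: Lambda6_def)

lemma Omega6_in_fiber6: "Omega6 \<beta> x \<in> fiber6 x"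
  unfolding Omega6_def fiber6_def by blast

lemma dom_Lambda6: "dom (Lambda6 x f) = fiber6 x"
  by (auto simp: Lambda6_def Let_def dom_def)

text \<open>
  Substituting the nilpotent part of \<open>u\<close> is a real algebra homomorphism on formal power series, as
  is truncation.  Linearity and multiplicativity of \<open>\<Lambda>\<close> are therefore inherited from those of
  jets; they hold at every point of the fibre.
\<close>

lemma Lambda6_plus:
  assumes "f \<in> D_space 5 x" "g \<in> D_space 5 x"
  shows "Lambda6 x (f +\<^sub>m g) = Lambda6 x f +\<^sub>m Lambda6 x g"
proof -
  obtain F G where F: "has_jet 5 (\<lambda>y. the (f y)) x F" and G: "has_jet 5 (\<lambda>y. the (g y)) x G"
    using assms by (metis D_space_has_jet)
  note L = F[THEN Lambda6_eq_compose] G[THEN Lambda6_eq_compose]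
    has_jet_pm_plus[OF assms F G, THEN Lambda6_eq_compose]
  show ?thesis
    by (rule ext, unfold pm_plus_def[of "Lambda6 x f"])
       (simp add: dom_Lambda6 L fps_compose_add_distrib trunc_fps_add)
qed

lemma Lambda6_scale:
  assumes "f \<in> D_space 5 x"
  shows "Lambda6 x (r *\<^sub>s f) = r *\<^sub>s Lambda6 x f"
proof -
  obtain F where F: "has_jet 5 (\<lambda>y. the (f y)) x F"
    using assms by (metis D_space_has_jet)
  note L = F[THEN Lambda6_eq_compose] has_jet_pm_scale[OF assms F, THEN Lambda6_eq_compose]
  show ?thesis
    by (rule ext, unfold pm_scale_def[of _ "Lambda6 x f"])
       (simp add: dom_Lambda6 L fps_compose_mult_distrib nilpotent_part_nth trunc_fps_const_mult)
qed

lemma Lambda6_times: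
  assumes "f \<in> D_space 5 x" "g \<in> D_space 5 x"
  shows "Lambda6 x (f *\<^sub>m g) = Lambda6 x f *\<^sub>m Lambda6 x g"
proof -
  obtain F G where F: "has_jet 5 (\<lambda>y. the (f y)) x F" and G: "has_jet 5 (\<lambda>y. the (g y)) x G"
    using assms by (metis D_space_has_jet)
  note L = F[THEN Lambda6_eq_compose] G[THEN Lambda6_eq_compose]
    has_jet_pm_times[OF assms F G, THEN Lambda6_eq_compose]
  show ?thesis
    by (rule ext, unfold pm_times_def[of "Lambda6 x f"])
       (simp add: dom_Lambda6 L fps_compose_mult_distrib nilpotent_part_nth trunc_fps_mult)
qed

lemma ran_Lambda6:
  assumes "f \<in> D_space 5 x"
  shows "ran (Lambda6 x f) \<subseteq> fiber6 (the (f x))"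
proof -
  obtain F where F: "has_jet 5 (\<lambda>y. the (f y)) x F"
    using assms by (metis D_space_has_jet)
  show ?thesis
    using has_jet_value[OF F]
    by (auto simp: ran_def Lambda6_eq_compose[OF F] fiber6_eq trunc_fps.rep_eq split: if_splits)
qed

text \<open>
  If \<open>F\<close> and \<open>G\<close> are the jets of \<open>f\<close> and \<open>g\<close> and \<open>G\<^sub>0 = g x\<close>, then the two sides are obtained from
  \<open>(F \<circ> (G - G\<^sub>0)) \<circ> N\<close> and \<open>F \<circ> ((G - G\<^sub>0) \<circ> N)\<close>, where \<open>N\<close> is the nilpotent part of the
  argument; these agree because formal composition is associative.
\<close>

lemma Lambda6_compose:
  assumes "g \<in> D_space 5 x" "f \<in> D_space 5 (the (g x))"
    and I: "open_interval I" "x \<in> I" "I \<subseteq> dom (f \<circ>\<^sub>m g)"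
  shows "Lambda6 x ((f \<circ>\<^sub>m g) |` I) = Lambda6 (the (g x)) f \<circ>\<^sub>m Lambda6 x g"
proof
  fix u :: "6 trunc_poly"
  obtain F G where F: "has_jet 5 (\<lambda>y. the (f y)) (the (g x)) F"
    and G: "has_jet 5 (\<lambda>y. the (g y)) x G"
    using assms by (metis D_space_has_jet)
  note L = F[THEN Lambda6_eq_compose] G[THEN Lambda6_eq_compose]
    has_jet_map_comp_restrict[OF I F G, THEN Lambda6_eq_compose]
  let ?v = "trunc_fps (G oo nilpotent_part u) :: 6 trunc_poly"
  have G0: "fps_nth G 0 = the (g x)"
    using has_jet_value[OF G] .
  show "Lambda6 x ((f \<circ>\<^sub>m g) |` I) u = (Lambda6 (the (g x)) f \<circ>\<^sub>m Lambda6 x g) u"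
  proof (cases "u \<in> fiber6 x")
    case True
    have "?v \<in> fiber6 (the (g x))"
      by (simp add: fiber6_eq trunc_fps.rep_eq G0)
    moreover have "F oo (G - fps_const (the (g x))) oo nilpotent_part u =
        F oo ((G oo nilpotent_part u) - fps_const (the (g x)))"
      by (simp add: G0 nilpotent_part_nth fps_compose_sub_distrib flip: fps_compose_assoc)
    ultimately show ?thesis
      using True by (simp add: L trunc_fps_compose G0)
  qed (simp add: L)
qed

section \<open>The integration functional\<close>

lemma has_integral_taylor_poly:
  assumes "a \<le> b"
  shows "(taylor_poly n c f has_integral
    (\<Sum>i=0..n. nth_deriv i f c / fact i * (((b - c) ^ Suc i - (a - c) ^ Suc i) / Suc i))) {a..b}"
  unfolding taylor_poly_def
proof (rule has_integral_sum)
  fix i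
  have "((\<lambda>x. (x - c) ^ i) has_integral (b - c) ^ Suc i / Suc i - (a - c) ^ Suc i / Suc i) {a..b}"
    by (rule fundamental_theorem_of_calculus[OF assms])
       (auto intro!: derivative_eq_intros simp del: power_Suc of_nat_Suc
         simp flip: has_real_derivative_iff_has_vector_derivative)
  then show "((\<lambda>x. nth_deriv i f c / fact i * (x - c) ^ i) has_integral
      nth_deriv i f c / fact i * (((b - c) ^ Suc i - (a - c) ^ Suc i) / Suc i)) {a..b}"
    by (intro has_integral_mult_right) (simp add: diff_divide_distrib)
qed simp

text \<open>
  Put \<open>N = (\<Sum>i=1..5. \<beta> i *\<^sub>R \<epsilon> ^ i)\<close>.  On the left stand, for \<open>k = 1, \<dots>, 5\<close>, the values at \<open>N ^ k\<close> of
  the functional with weights \<open>A i\<close>, on the right the moments \<open>\<integral>\<^sub>a\<^sup>b (x - c) ^ k dx\<close>.  As \<open>N ^ k\<close>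
  starts in degree \<open>k\<close> with coefficient \<open>\<beta> 1 ^ k \<noteq> 0\<close>, the system is triangular in the weights,
  and the recursion in the hypotheses is its back substitution.
\<close>

lemma Gamma6_moments:
  fixes a b c :: real and \<beta> A :: "nat \<Rightarrow> real"
  assumes "\<beta> 1 \<noteq> 0"
    and "A 5 = ((b - c) ^ 6 - (a - c) ^ 6) / (6 * \<beta> 1 ^ 5)"
    and "A 4 = ((b - c) ^ 5 - (a - c) ^ 5) / (5 * \<beta> 1 ^ 4) - 4 * \<beta> 2 * A 5 / \<beta> 1"
    and "A 3 = ((b - c) ^ 4 - (a - c) ^ 4) / (4 * \<beta> 1 ^ 3) - 3 * \<beta> 2 * A 4 / \<beta> 1
           - 3 * (\<beta> 3 / \<beta> 1 + \<beta> 2 ^ 2 / \<beta> 1 ^ 2) * A 5"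
    and "A 2 = ((b - c) ^ 3 - (a - c) ^ 3) / (3 * \<beta> 1 ^ 2) - 2 * \<beta> 2 * A 3 / \<beta> 1
           - (2 * \<beta> 3 / \<beta> 1 + \<beta> 2 ^ 2 / \<beta> 1 ^ 2) * A 4
           - 2 * (\<beta> 4 / \<beta> 1 + \<beta> 2 * \<beta> 3 / \<beta> 1 ^ 2) * A 5"
    and "A 1 = ((b - c) ^ 2 - (a - c) ^ 2) / (2 * \<beta> 1) - \<beta> 2 * A 2 / \<beta> 1
           - \<beta> 3 * A 3 / \<beta> 1 - \<beta> 4 * A 4 / \<beta> 1 - \<beta> 5 * A 5 / \<beta> 1"
  shows "\<beta> 1 * A 1 + \<beta> 2 * A 2 + \<beta> 3 * A 3 + \<beta> 4 * A 4 + \<beta> 5 * A 5 = ((b - c) ^ 2 - (a - c) ^ 2) / 2"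
    and "\<beta> 1 ^ 2 * A 2 + 2 * \<beta> 1 * \<beta> 2 * A 3 + (2 * \<beta> 1 * \<beta> 3 + \<beta> 2 ^ 2) * A 4
        + 2 * (\<beta> 1 * \<beta> 4 + \<beta> 2 * \<beta> 3) * A 5 = ((b - c) ^ 3 - (a - c) ^ 3) / 3"
    and "\<beta> 1 ^ 3 * A 3 + 3 * \<beta> 1 ^ 2 * \<beta> 2 * A 4
        + 3 * (\<beta> 1 ^ 2 * \<beta> 3 + \<beta> 1 * \<beta> 2 ^ 2) * A 5 = ((b - c) ^ 4 - (a - c) ^ 4) / 4"
    and "\<beta> 1 ^ 4 * A 4 + 4 * \<beta> 1 ^ 3 * \<beta> 2 * A 5 = ((b - c) ^ 5 - (a - c) ^ 5) / 5"
    and "\<beta> 1 ^ 5 * A 5 = ((b - c) ^ 6 - (a - c) ^ 6) / 6"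
proof -
  show "\<beta> 1 ^ 5 * A 5 = ((b - c) ^ 6 - (a - c) ^ 6) / 6"
    using assms(1) by (simp add: assms(2))
  show "\<beta> 1 ^ 4 * A 4 + 4 * \<beta> 1 ^ 3 * \<beta> 2 * A 5 = ((b - c) ^ 5 - (a - c) ^ 5) / 5"
    unfolding assms(3) using assms(1) by (simp add: field_simps power_numeral_reduce)
  show "\<beta> 1 ^ 3 * A 3 + 3 * \<beta> 1 ^ 2 * \<beta> 2 * A 4
        + 3 * (\<beta> 1 ^ 2 * \<beta> 3 + \<beta> 1 * \<beta> 2 ^ 2) * A 5 = ((b - c) ^ 4 - (a - c) ^ 4) / 4"
    unfolding assms(4) using assms(1) by (simp add: field_simps power_numeral_reduce)
  show "\<beta> 1 ^ 2 * A 2 + 2 * \<beta> 1 * \<beta> 2 * A 3 + (2 * \<beta> 1 * \<beta> 3 + \<beta> 2 ^ 2) * A 4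
        + 2 * (\<beta> 1 * \<beta> 4 + \<beta> 2 * \<beta> 3) * A 5 = ((b - c) ^ 3 - (a - c) ^ 3) / 3"
    unfolding assms(5) using assms(1) by (simp add: field_simps power_numeral_reduce)
  show "\<beta> 1 * A 1 + \<beta> 2 * A 2 + \<beta> 3 * A 3 + \<beta> 4 * A 4 + \<beta> 5 * A 5 = ((b - c) ^ 2 - (a - c) ^ 2) / 2"
    unfolding assms(6) using assms(1) by (simp add: field_simps)
qed

text \<open>
  Collecting \<open>\<Gamma>(\<Lambda>(f)(\<Omega>(c)))\<close> by derivatives of \<open>f\<close> gives \<open>f\<^sup>(\<^sup>k\<^sup>) c / k!\<close> times the value of the
  functional at the \<open>k\<close>-th power of the nilpotent part of \<open>\<Omega>(c)\<close>, so that the moment equations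
  turn it into the termwise integral of the Taylor polynomial.
\<close>

lemma Gamma6_Lambda6_Omega6:
  assumes "a \<le> b" and "\<beta> 1 * A 1 + \<beta> 2 * A 2 + \<beta> 3 * A 3 + \<beta> 4 * A 4 + \<beta> 5 * A 5
        = ((b - c) ^ 2 - (a - c) ^ 2) / 2"
    and "\<beta> 1 ^ 2 * A 2 + 2 * \<beta> 1 * \<beta> 2 * A 3 + (2 * \<beta> 1 * \<beta> 3 + \<beta> 2 ^ 2) * A 4
        + 2 * (\<beta> 1 * \<beta> 4 + \<beta> 2 * \<beta> 3) * A 5 = ((b - c) ^ 3 - (a - c) ^ 3) / 3"
    and "\<beta> 1 ^ 3 * A 3 + 3 * \<beta> 1 ^ 2 * \<beta> 2 * A 4
        + 3 * (\<beta> 1 ^ 2 * \<beta> 3 + \<beta> 1 * \<beta> 2 ^ 2) * A 5 = ((b - c) ^ 4 - (a - c) ^ 4) / 4"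
    and "\<beta> 1 ^ 4 * A 4 + 4 * \<beta> 1 ^ 3 * \<beta> 2 * A 5 = ((b - c) ^ 5 - (a - c) ^ 5) / 5"
    and "\<beta> 1 ^ 5 * A 5 = ((b - c) ^ 6 - (a - c) ^ 6) / 6"
  shows "map_option (Gamma6 a b A) (Lambda6 c f (Omega6 \<beta> c)) =
    Some (integral {a..b} (taylor_poly 5 c f))"
proof -
  let ?d = "\<lambda>k. nth_deriv k f c"
  have \<beta>: "tcoeff (Omega6 \<beta> c) i = \<beta> i" if "i \<in> {1..5}" for i
    using that by (simp add: Omega6_def tcoeff_teps_sum del: One_nat_def)
  have from1: "{1..5} = {1, 2, 3, 4, 5::nat}" and from0: "{0..5} = {0, 1, 2, 3, 4, 5::nat}" by auto
  obtain v where v: "Lambda6 c f (Omega6 \<beta> c) = Some v"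
    using Omega6_in_fiber6[of \<beta> c] by (auto simp: Lambda6_def Let_def)
  have "Gamma6 a b A v = (b - a) * ?d 0
      + ?d 1 * (\<beta> 1 * A 1 + \<beta> 2 * A 2 + \<beta> 3 * A 3 + \<beta> 4 * A 4 + \<beta> 5 * A 5)
      + ?d 2 / 2 * (\<beta> 1 ^ 2 * A 2 + 2 * \<beta> 1 * \<beta> 2 * A 3 + (2 * \<beta> 1 * \<beta> 3 + \<beta> 2 ^ 2) * A 4
        + 2 * (\<beta> 1 * \<beta> 4 + \<beta> 2 * \<beta> 3) * A 5)
      + ?d 3 / 6 * (\<beta> 1 ^ 3 * A 3 + 3 * \<beta> 1 ^ 2 * \<beta> 2 * A 4
        + 3 * (\<beta> 1 ^ 2 * \<beta> 3 + \<beta> 1 * \<beta> 2 ^ 2) * A 5)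
      + ?d 4 / 24 * (\<beta> 1 ^ 4 * A 4 + 4 * \<beta> 1 ^ 3 * \<beta> 2 * A 5)
      + ?d 5 / 120 * (\<beta> 1 ^ 5 * A 5)"
  proof -
    have "tcoeff v 0 = ?d 0" "tcoeff v 1 = \<beta> 1 * ?d 1"
      "tcoeff v 2 = \<beta> 2 * ?d 1 + 1 / 2 * \<beta> 1 ^ 2 * ?d 2"
      "tcoeff v 3 = \<beta> 3 * ?d 1 + \<beta> 1 * \<beta> 2 * ?d 2 + 1 / 6 * \<beta> 1 ^ 3 * ?d 3"
      "tcoeff v 4 = \<beta> 4 * ?d 1 + (\<beta> 1 * \<beta> 3 + 1 / 2 * \<beta> 2 ^ 2) * ?d 2
        + 1 / 2 * \<beta> 1 ^ 2 * \<beta> 2 * ?d 3 + 1 / 24 * \<beta> 1 ^ 4 * ?d 4"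
      "tcoeff v 5 = \<beta> 5 * ?d 1 + (\<beta> 1 * \<beta> 4 + \<beta> 2 * \<beta> 3) * ?d 2
        + 1 / 2 * (\<beta> 1 ^ 2 * \<beta> 3 + \<beta> 1 * \<beta> 2 ^ 2) * ?d 3
        + 1 / 6 * \<beta> 1 ^ 3 * \<beta> 2 * ?d 4 + 1 / 120 * \<beta> 1 ^ 5 * ?d 5"
      using v Omega6_in_fiber6[of \<beta> c]
      by (auto simp: Lambda6_def Let_def plus_trunc_poly.rep_eq scaleR_trunc_poly.rep_eq
          tcoeff_of_real tcoeff_teps_power tcoeff_teps \<beta> nth_deriv_def[of 0] fact_numeral simp flip: One_nat_def)
    then show ?thesis
      by (simp add: Gamma6_def from1 algebra_simps flip: One_nat_def)
  qed
  also have "\<dots> = (\<Sum>i=0..5. ?d i / fact i * (((b - c) ^ Suc i - (a - c) ^ Suc i) / Suc i))"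
    unfolding assms(2-) by (simp add: from0 fact_numeral power_numeral_reduce[where 'a = real] flip: One_nat_def)
  also have "\<dots> = integral {a..b} (taylor_poly 5 c f)"
    using has_integral_taylor_poly[OF assms(1), of 5 c f] by (simp add: integral_unique)
  finally show ?thesis
    by (simp add: v)
qed

theorem proposition2p1:
  fixes a b c :: real and \<beta> A :: "nat \<Rightarrow> real"
  assumes "a \<le> b" and "c \<in> {a..b}" and "\<beta> 1 \<noteq> 0"
    and "A 5 = ((b - c) ^ 6 - (a - c) ^ 6) / (6 * \<beta> 1 ^ 5)"
    and "A 4 = ((b - c) ^ 5 - (a - c) ^ 5) / (5 * \<beta> 1 ^ 4) - 4 * \<beta> 2 * A 5 / \<beta> 1"
    and "A 3 = ((b - c) ^ 4 - (a - c) ^ 4) / (4 * \<beta> 1 ^ 3) - 3 * \<beta> 2 * A 4 / \<beta> 1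
           - 3 * (\<beta> 3 / \<beta> 1 + \<beta> 2 ^ 2 / \<beta> 1 ^ 2) * A 5"
    and "A 2 = ((b - c) ^ 3 - (a - c) ^ 3) / (3 * \<beta> 1 ^ 2) - 2 * \<beta> 2 * A 3 / \<beta> 1
           - (2 * \<beta> 3 / \<beta> 1 + \<beta> 2 ^ 2 / \<beta> 1 ^ 2) * A 4
           - 2 * (\<beta> 4 / \<beta> 1 + \<beta> 2 * \<beta> 3 / \<beta> 1 ^ 2) * A 5"
    and "A 1 = ((b - c) ^ 2 - (a - c) ^ 2) / (2 * \<beta> 1) - \<beta> 2 * A 2 / \<beta> 1
           - \<beta> 3 * A 3 / \<beta> 1 - \<beta> 4 * A 4 / \<beta> 1 - \<beta> 5 * A 5 / \<beta> 1"
  shows "automatic_integration 5 a b c Lambda6 (Omega6 \<beta>) (Gamma6 a b A)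
    \<and> automatic_integration_on fiber6 5 a b c Lambda6 (Omega6 \<beta>) (Gamma6 a b A)"
proof -
  have "map_option (Gamma6 a b A) (Lambda6 c f (Omega6 \<beta> c)) =
      Some (integral {a..b} (taylor_poly 5 c f))" for f
    by (rule Gamma6_Lambda6_Omega6[OF assms(1) Gamma6_moments[OF assms(3-8)]])
  then have "automatic_integration_on fiber6 5 a b c Lambda6 (Omega6 \<beta>) (Gamma6 a b A)"
    unfolding automatic_integration_on_def fun_space_def
    using assms(1,2) by (simp add: Omega6_in_fiber6 dom_Lambda6 image_subset_iff ran_Lambda6
        Lambda6_plus Lambda6_scale Lambda6_times Lambda6_compose)
  then show ?thesis
    unfolding automatic_integration_def by blast
qed

end
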